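(* Let $w\in S_n$ be a permutation. The maximum length of a chain (number of elements in the chain) in the poset $(\mathrm{RPD}(w),\le)$ is $$1+\sum_{(x,y)\in\mathrm{Inv}(w^{-1})}R_{xy}(w),$$ where $R_{xy}(w)=\#\{i<w^{-1}(y): w(i)\le x\}$.
   Context: A pipe dream is a finite subset $D\subset \mathbb{Z}_{>0}\times\mathbb{Z}_{>0}$, in matrix coordinates ($(i,j)$ is row $i$ from the top, column $j$ from the left). Place a cross tile at each $(i,j)\in D$ (one strand joins the left and right edges, the other joins the top and bottom edges) and a bump tile at each $(i,j)\notin D$ (one strand joins the top edge to the left edge, the other joins the right edge to the bottom edge). Write $D(i,j)=+$ if $(i,j)\in D$ and $D(i,j)=\bullet$ otherwise. The strands form pipes going from the top boundary to the left boundary; pipe $x$ is the one entering at the top of column $x$. The permutation $w$ of $D$ is defined by: $w(i)$ is the label of the pipe that exits the left boundary in row $i$. Permutations $w\in S_n$ are regarded as permutations of $\mathbb{Z}_{>0}$ fixing all $m>n$. $\mathrm{RPD}(w)$ is the set of reduced pipe dreams for $w$: pipe dreams $D$ whose permutation is $w$ and such that $|D|$ equals the number of inversions of $w$. Generalized ladder move: let $D\in\mathrm{RPD}(w)$, and suppose there are $h<i$ and $j<k$ such that $D(i,j)=+$, $D(h,j)=D(i,k)=D(h,k)=\bullet$, and every other tile in $[h,i]\times[j,k]$ is a $+$. Then $(i,j)$ is called ladder movable in $D$, and $\mathcal{L}_{ij}(D)\in\mathrm{RPD}(w)$ is obtained from $D$ by swapping the tiles at $(i,j)$ and $(h,k)$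 (given $(i,j)$, the pair $(h,k)$ is unique). Order: $D\le D'$ in $\mathrm{RPD}(w)$ iff $D'$ can be obtained from $D$ by a (possibly empty) sequence of generalized ladder moves. $\mathrm{Inv}(w^{-1})=\{(x,y)\in[n]^2: x<y,\ w^{-1}(x)>w^{-1}(y)\}$. *)

theory Defs
  imports "HOL-Combinatorics.Permutations"
begin

text \<open>Pipe dreams are finite sets of cross tiles in matrix coordinates: \<open>(i, j)\<close> is row \<open>i\<close>
  from the top and column \<open>j\<close> from the left, both at least \<open>1\<close>. All other tiles are bumps.\<close>

definition pipe_dream :: "(nat \<times> nat) set \<Rightarrow> bool" where
  "pipe_dream D \<longleftrightarrow> finite D \<and> D \<subseteq> {1..} \<times> {1..}"

datatype side = Top | Right

text \<open>\<open>enters D x i j s\<close>: travelling from its start on the top boundary, pipe \<open>x\<close> enters tile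
  \<open>(i, j)\<close> through its side \<open>s\<close>. Pipes only travel downwards and leftwards, so a tile is always
  entered from the top or from the right. Column \<open>0\<close> contains no tiles: entering \<open>(i, 0)\<close> from
  the right means having left the grid through the left boundary in row \<open>i\<close>.\<close>

inductive enters :: "(nat \<times> nat) set \<Rightarrow> nat \<Rightarrow> nat \<Rightarrow> nat \<Rightarrow> side \<Rightarrow> bool"
  for D :: "(nat \<times> nat) set" and x :: nat where
  start: "1 \<le> x \<Longrightarrow> enters D x 1 x Top"
| cross_vertical: "enters D x i j Top \<Longrightarrow> 1 \<le> j \<Longrightarrow> (i, j) \<in> D \<Longrightarrow> enters D x (i + 1) j Top"
| cross_horizontal: "enters D x i j Right \<Longrightarrow> 1 \<le> j \<Longrightarrow> (i, j) \<in> D \<Longrightarrow> enters D x i (j - 1) Right"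
| bump_top_left: "enters D x i j Top \<Longrightarrow> 1 \<le> j \<Longrightarrow> (i, j) \<notin> D \<Longrightarrow> enters D x i (j - 1) Right"
| bump_right_bottom: "enters D x i j Right \<Longrightarrow> 1 \<le> j \<Longrightarrow> (i, j) \<notin> D \<Longrightarrow> enters D x (i + 1) j Top"

definition pipe_exits :: "(nat \<times> nat) set \<Rightarrow> nat \<Rightarrow> nat \<Rightarrow> bool" where
  "pipe_exits D x i \<longleftrightarrow> enters D x i 0 Right"

definition has_permutation :: "(nat \<times> nat) set \<Rightarrow> (nat \<Rightarrow> nat) \<Rightarrow> bool" where
  "has_permutation D w \<longleftrightarrow> (\<forall>i\<ge>1. pipe_exits D (w i) i)"

definition inversions :: "(nat \<Rightarrow> nat) \<Rightarrow> (nat \<times> nat) set" where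
  "inversions w = {(i, j). 1 \<le> i \<and> i < j \<and> w i > w j}"

definition RPD :: "(nat \<Rightarrow> nat) \<Rightarrow> (nat \<times> nat) set set" where
  "RPD w = {D. pipe_dream D \<and> has_permutation D w \<and> card D = card (inversions w)}"

text \<open>\<open>ladder_movable D i j h k\<close>: the cross at \<open>(i, j)\<close> can be moved to \<open>(h, k)\<close>.\<close>

definition ladder_movable ::
  "(nat \<times> nat) set \<Rightarrow> nat \<Rightarrow> nat \<Rightarrow> nat \<Rightarrow> nat \<Rightarrow> bool" where
  "ladder_movable D i j h k \<longleftrightarrow>
     1 \<le> h \<and> h < i \<and> 1 \<le> j \<and> j < k \<and>
     (i, j) \<in> D \<and> (h, j) \<notin> D \<and> (i, k) \<notin> D \<and> (h, k) \<notin> D \<and>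
     {h..i} \<times> {j..k} - {(h, j), (i, k), (h, k)} \<subseteq> D"

definition ladder_move :: "(nat \<times> nat) set \<Rightarrow> (nat \<times> nat) set \<Rightarrow> bool" where
  "ladder_move D D' \<longleftrightarrow>
     (\<exists>i j h k. ladder_movable D i j h k \<and> D' = insert (h, k) (D - {(i, j)}))"

definition ladder_order :: "(nat \<Rightarrow> nat) \<Rightarrow> (nat \<times> nat) set rel" where
  "ladder_order w = {(D, D'). D \<in> RPD w \<and> D' \<in> RPD w \<and> ladder_move\<^sup>*\<^sup>* D D'}"

definition Inv_inverse :: "nat \<Rightarrow> (nat \<Rightarrow> nat) \<Rightarrow> (nat \<times> nat) set" where
  "Inv_inverse n w = {(x, y) \<in> {1..n} \<times> {1..n}. x < y \<and> inv w x > inv w y}"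

definition R_stat :: "(nat \<Rightarrow> nat) \<Rightarrow> nat \<Rightarrow> nat \<Rightarrow> nat" where
  "R_stat w x y = card {i. 1 \<le> i \<and> i < inv w y \<and> w i \<le> x}"

lemma ladder_move_decreases:
  assumes "ladder_move D D'" "finite D"
  shows "finite D' \<and> sum fst D' < sum fst D"
proof -
  obtain i j h k where m: "ladder_movable D i j h k" and D': "D' = insert (h, k) (D - {(i, j)})"
    using assms(1) unfolding ladder_move_def by blast
  have "(i, j) \<in> D" "(h, k) \<notin> D" "h < i"
    using m unfolding ladder_movable_def by auto
  moreover have "sum fst D = i + sum fst (D - {(i, j)})"
    using calculation assms(2) by (simp add: sum.remove)
  moreover have "sum fst D' = h + sum fst (D - {(i, j)})"
    using calculation assms(2) D' by simp
  ultimately show ?thesis using D' assms(2) by simp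
qed

lemma ladder_moves_decrease:
  assumes "ladder_move\<^sup>*\<^sup>* D D'" "finite D"
  shows "finite D' \<and> (D = D' \<or> sum fst D' < sum fst D)"
  using assms
proof (induction rule: rtranclp_induct)
  case base
  then show ?case by simp
next
  case (step y z)
  then have y: "finite y" "sum fst y \<le> sum fst D" by auto
  with step.hyps(2) have "finite z \<and> sum fst z < sum fst y"
    by (intro ladder_move_decreases)
  with y show ?case by linarith
qed

lemma partial_order_on_ladder_order: "partial_order_on (RPD w) (ladder_order w)"
proof -
  have "antisym (ladder_order w)"
  proof (rule antisymI)
    fix D D' assume "(D, D') \<in> ladder_order w" "(D', D) \<in> ladder_order w"
    then have "finite D" "finite D'" "ladder_move\<^sup>*\<^sup>* D D'" "ladder_move\<^sup>*\<^sup>* D' D"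
      by (simp_all add: ladder_order_def RPD_def pipe_dream_def)
    then show "D = D'"
      using ladder_moves_decrease[of D D'] ladder_moves_decrease[of D' D] by (metis less_asym)
  qed
  moreover have "trans (ladder_order w)"
    proof (rule transI)
    fix A B C assume "(A, B) \<in> ladder_order w" "(B, C) \<in> ladder_order w"
    then show "(A, C) \<in> ladder_order w"
      unfolding ladder_order_def using rtranclp_trans[of ladder_move A B C] by simp
  qed
  moreover have "refl_on (RPD w) (ladder_order w)"
    by (simp add: ladder_order_def refl_on_def)
  moreover have "ladder_order w \<subseteq> RPD w \<times> RPD w"
    unfolding ladder_order_def by blast
  ultimately show ?thesis
    unfolding partial_order_on_def preorder_on_def by blast
qed

end

theory Submission
  imports Defs
begin

text \<open>The potential is the sum of the columns of all crosses, which every ladder move increases. In a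
  reduced pipe dream the crosses correspond to the inversions \<open>x < y\<close> of \<open>w\<^sup>-\<^sup>1\<close>, pipe \<open>x\<close>
  passing vertically and pipe \<open>y\<close> horizontally. Since pipes only move left, the crossing of \<open>x\<close>
  and \<open>y\<close> lies in a column at most \<open>x\<close>, and the crossings passed horizontally by a fixed \<open>y\<close> lie in
  distinct columns. The two resulting bounds on the potential differ by exactly the sum of the
  \<open>R\<^sub>x\<^sub>y\<close>. The upper one is attained by the top-justified pipe dream, the lower one
  by every left-justified one. As long as a pipe dream is not left-justified, the argument of
  Bergeron and Billey yields an inverse ladder move between adjacent columns, which lowers the
  potential by one.\<close>

section \<open>The column of a pipe in each row\<close>

text \<open>The nearest bump strictly left of column \<open>a\<close>, where a pipe that turned left
  at \<open>a\<close> turns down again. The value 0 means that it reaches the left boundary.\<close>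

primrec next_bump :: "(nat \<times> nat) set \<Rightarrow> nat \<Rightarrow> nat \<Rightarrow> nat" where
  "next_bump D r 0 = 0"
| "next_bump D r (Suc a) = (if (r, a) \<in> D then next_bump D r a else a)"

definition row_step :: "(nat \<times> nat) set \<Rightarrow> nat \<Rightarrow> nat \<Rightarrow> nat" where
  "row_step D r a = (if (r, a) \<in> D then a else next_bump D r a)"

text \<open>\<open>pipe_col D x r\<close> is the column in which pipe \<open>x\<close> enters row \<open>r\<close> from the top, and \<open>0\<close> if the
  pipe has left the grid above row \<open>r\<close>. Row \<open>0\<close> is a dummy.\<close>

fun pipe_col :: "(nat \<times> nat) set \<Rightarrow> nat \<Rightarrow> nat \<Rightarrow> nat" where
  "pipe_col D x 0 = x"
| "pipe_col D x (Suc r) = (if r = 0 then x else row_step D r (pipe_col D x r))"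

lemma pipe_col_Suc: "1 \<le> r \<Longrightarrow> pipe_col D x (Suc r) = row_step D r (pipe_col D x r)"
  by simp

declare pipe_col.simps(2) [simp del]

lemma pipe_col_1 [simp]: "pipe_col D x (Suc 0) = x"
  by (simp add: pipe_col.simps)

lemma pipe_dream_zero: "pipe_dream D \<Longrightarrow> (r, 0) \<notin> D" "pipe_dream D \<Longrightarrow> (0, c) \<notin> D"
  by (auto simp: pipe_dream_def)

lemma next_bump_le: "next_bump D r a \<le> a"
  by (induction a) auto

lemma next_bump_less: "1 \<le> a \<Longrightarrow> next_bump D r a < a"
  by (cases a) (auto simp: less_Suc_eq_le next_bump_le)

lemma next_bump_notin: "pipe_dream D \<Longrightarrow> (r, next_bump D r a) \<notin> D"
  by (induction a) (auto simp: pipe_dream_zero)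

lemma between_next_bump: "next_bump D r a < m \<Longrightarrow> m < a \<Longrightarrow> (r, m) \<in> D"
  by (induction a) (auto simp: less_Suc_eq split: if_splits)

lemma next_bump_ge: "(r, m) \<notin> D \<Longrightarrow> m < a \<Longrightarrow> m \<le> next_bump D r a"
  by (meson between_next_bump not_le)

lemma next_bump_eqI:
  assumes "pipe_dream D" "(r, m) \<notin> D" "m < a" "\<And>c. m < c \<Longrightarrow> c < a \<Longrightarrow> (r, c) \<in> D"
  shows "next_bump D r a = m"
  using next_bump_ge[OF assms(2,3)] next_bump_less[of a D r] next_bump_notin[OF assms(1), of r a]
    assms(3,4) by (metis le_neq_implies_less less_one linorder_not_less not_less_zero)

lemma row_step_le: "row_step D r a \<le> a"
  by (simp add: row_step_def next_bump_le)

lemma row_step_eq_iff: "1 \<le> a \<Longrightarrow> row_step D r a = a \<longleftrightarrow> (r, a) \<in> D"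
  using next_bump_less[of a D r] by (auto simp: row_step_def)

text \<open>Two pipes keep their order unless the left one goes straight: if it turned at a bump in
  column \<open>a\<close>, that bump would stop the right pipe no further left than
  \<open>a\<close>, while the left pipe ends left of \<open>a\<close>.\<close>

lemma row_step_mono_or_cross:
  assumes "pipe_dream D" "1 \<le> a" "a < b" "row_step D r b \<le> row_step D r a" "0 < row_step D r a"
  shows "row_step D r a = a \<and> row_step D r b < a"
proof -
  have "(r, b) \<notin> D"
    using assms row_step_le[of D r a] by (auto simp: row_step_def)
  then have b: "row_step D r b = next_bump D r b" by (simp add: row_step_def)
  have "(r, a) \<in> D"
  proof (rule ccontr)
    assume "(r, a) \<notin> D"
    then have "a \<le> next_bump D r b" "row_step D r a < a"
      using assms next_bump_ge next_bump_less by (auto simp: row_step_def)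
    then show False using b assms by simp
  qed
  then have a: "row_step D r a = a" by (simp add: row_step_def)
  moreover have "next_bump D r b \<noteq> a"
    using next_bump_notin[OF assms(1)] \<open>(r, a) \<in> D\<close> by metis
  ultimately show ?thesis using assms b by simp
qed

text \<open>Pipes can only merge in column 0, where all those that have left the grid are
  collected.\<close>

lemma row_step_inj:
  assumes "pipe_dream D" "row_step D r a = row_step D r b" "0 < row_step D r a"
  shows "a = b"
proof -
  have *: False if "a < b" "row_step D r a = row_step D r b" "0 < row_step D r a" for a b
    using row_step_mono_or_cross[of D a b r] assms(1) that row_step_le[of D r a] by auto
  show ?thesis using *[of a b] *[of b a] assms by (metis nat_neq_iff)
qed

lemma pipe_col_antimono:
  assumes "r \<le> s" shows "pipe_col D x s \<le> pipe_col D x r"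
proof -
  have "pipe_col D x (Suc r) \<le> pipe_col D x r" for r
    by (cases "r = 0") (auto simp: pipe_col_Suc row_step_le)
  then show ?thesis using assms by (rule lift_Suc_antimono_le)
qed

lemma pipe_col_le: "pipe_col D x r \<le> x"
  using pipe_col_antimono[of 0 r D x] by simp

lemma pipe_col_inj:
  assumes "pipe_dream D" "pipe_col D x r = pipe_col D y r" "0 < pipe_col D x r"
  shows "x = y"
  using assms(2,3)
proof (induction r)
  case (Suc r)
  show ?case
  proof (cases "r = 0")
    case False
    then have "pipe_col D x r = pipe_col D y r"
      using Suc.prems row_step_inj[OF assms(1)] by (simp add: pipe_col_Suc)
    then show ?thesis
      using Suc pipe_col_antimono[of r "Suc r" D x] by simp
  qed (use Suc.prems in simp)
qed simp

text \<open>Translates the tile-by-tile trace into columns. A pipe entering a tile from the right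
  has turned at the bump in column \<open>pipe_col D x i\<close> and has not gone past the next
  bump.\<close>

lemma enters_pipe_col:
  assumes "pipe_dream D" "enters D x i j s"
  shows "1 \<le> i \<and> (case s of Top \<Rightarrow> 1 \<le> j \<and> pipe_col D x i = j
    | Right \<Rightarrow> j < pipe_col D x i \<and> next_bump D i (pipe_col D x i) \<le> j \<and> (i, pipe_col D x i) \<notin> D)"
  using assms(2)
proof induction
  case (cross_horizontal i j)
  then have "next_bump D i (pipe_col D x i) \<noteq> j"
    using next_bump_notin[OF assms(1)] by metis
  then show ?case using cross_horizontal by auto
next
  case (bump_top_left i j)
  then show ?case using next_bump_less[of j D i] by auto
next
  case (bump_right_bottom i j)
  then have "next_bump D i (pipe_col D x i) = j"
    using next_bump_ge[of i j D "pipe_col D x i"] by auto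
  then show ?case using bump_right_bottom by (auto simp: pipe_col_Suc row_step_def)
qed (auto simp: pipe_col_Suc row_step_def)

lemma enters_Right_sweep:
  assumes "enters D x i a Top" "1 \<le> a" "(i, a) \<notin> D" "next_bump D i a \<le> m" "m < a"
  shows "enters D x i m Right"
proof -
  have "m \<le> a - 1" using assms by simp
  then show ?thesis using assms(4)
  proof (induction rule: inc_induct)
    case base
    then show ?case using assms enters.bump_top_left by blast
  next
    case (step m)
    then have "enters D x i (Suc m) Right" "(i, Suc m) \<in> D"
      using between_next_bump[of D i a "Suc m"] by auto
    then show ?case using enters.cross_horizontal[of D x i "Suc m"] by simp
  qed
qed

lemma pipe_col_enters:
  assumes "pipe_dream D" "1 \<le> i" "0 < pipe_col D x i"
  shows "enters D x i (pipe_col D x i) Top"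
  using assms(2,3)
proof (induction i rule: dec_induct)
  case base
  then show ?case using enters.start[of x D] by simp
next
  case (step i)
  let ?a = "pipe_col D x i"
  have a: "0 < ?a" using step.prems pipe_col_antimono[of i "Suc i" D x] by simp
  then have e: "enters D x i ?a Top" using step by blast
  have s: "pipe_col D x (Suc i) = row_step D i ?a" using step.hyps by (simp add: pipe_col_Suc)
  show ?case
  proof (cases "(i, ?a) \<in> D")
    case True
    then show ?thesis using e a s enters.cross_vertical[of D x i ?a] by (simp add: row_step_def)
  next
    case False
    then have "enters D x i (next_bump D i ?a) Right"
      using enters_Right_sweep[OF e] a next_bump_less[of ?a D i] by simp
    then show ?thesis
      using enters.bump_right_bottom[of D x i "next_bump D i ?a"] False s step.prems
        next_bump_notin[OF assms(1)] by (simp add: row_step_def)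
  qed
qed

lemma pipe_exits_iff:
  assumes "pipe_dream D"
  shows "pipe_exits D x i \<longleftrightarrow> 1 \<le> i \<and> 0 < pipe_col D x i \<and> pipe_col D x (Suc i) = 0"
proof
  assume "pipe_exits D x i"
  then show "1 \<le> i \<and> 0 < pipe_col D x i \<and> pipe_col D x (Suc i) = 0"
    using enters_pipe_col[OF assms, of x i 0 Right]
    by (auto simp: pipe_exits_def pipe_col_Suc row_step_def)
next
  assume *: "1 \<le> i \<and> 0 < pipe_col D x i \<and> pipe_col D x (Suc i) = 0"
  then have "row_step D i (pipe_col D x i) = 0" using pipe_col_Suc[of i D x] by simp
  with * have "(i, pipe_col D x i) \<notin> D" "next_bump D i (pipe_col D x i) = 0"
    by (auto simp: row_step_def split: if_splits)
  then show "pipe_exits D x i"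
    using enters_Right_sweep[OF pipe_col_enters[OF assms]] * by (simp add: pipe_exits_def)
qed

lemma has_permutation_iff:
  assumes "pipe_dream D"
  shows "has_permutation D w \<longleftrightarrow>
    (\<forall>i\<ge>1. 0 < pipe_col D (w i) i \<and> pipe_col D (w i) (Suc i) = 0)"
  by (auto simp: has_permutation_def pipe_exits_iff[OF assms])

section \<open>Crossings and inversions\<close>

text \<open>Pipe \<open>x\<close> passes the cross vertically. Pipe \<open>y\<close> passes it horizontally, because it starts to the
  right of it in row \<open>i\<close> and leaves that row to the left of it.\<close>

definition crosses_at :: "(nat \<times> nat) set \<Rightarrow> nat \<Rightarrow> nat \<Rightarrow> nat \<times> nat \<Rightarrow> bool" where
  "crosses_at D x y = (\<lambda>(i, j). (i, j) \<in> D \<and> pipe_col D x i = j \<and>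
     pipe_col D y (Suc i) < j \<and> j < pipe_col D y i)"

lemma crosses_at_row: "pipe_dream D \<Longrightarrow> crosses_at D x y (i, j) \<Longrightarrow> 1 \<le> i \<and> 1 \<le> j"
  by (auto simp: crosses_at_def pipe_dream_def)

lemma crosses_at_bump:
  assumes "pipe_dream D" "crosses_at D x y (i, j)"
  shows "(i, pipe_col D y i) \<notin> D" "pipe_col D y (Suc i) = next_bump D i (pipe_col D y i)"
proof -
  have "row_step D i (pipe_col D y i) \<noteq> pipe_col D y i"
    using assms crosses_at_row[OF assms] by (auto simp: crosses_at_def pipe_col_Suc)
  then show "(i, pipe_col D y i) \<notin> D" by (auto simp: row_step_def)
  then show "pipe_col D y (Suc i) = next_bump D i (pipe_col D y i)"
    using crosses_at_row[OF assms] by (auto simp: pipe_col_Suc row_step_def)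
qed

text \<open>The vertical pipe is the one in column \<open>j\<close>. The horizontal one comes from a
  bump right of \<open>j\<close>: of two candidates, the one further right would be stopped by the
  bump of the other.\<close>

lemma crosses_at_inj:
  assumes "pipe_dream D" "crosses_at D x y t" "crosses_at D x' y' t"
  shows "x = x' \<and> y = y'"
proof -
  obtain i j where t: "t = (i, j)" by force
  note c = assms(2,3)[unfolded t]
  have "x = x'"
    using c crosses_at_row[OF assms(1)] pipe_col_inj[OF assms(1)] by (force simp: crosses_at_def)
  moreover have "pipe_col D y i = pipe_col D y' i"
    using next_bump_ge[of i "pipe_col D y i" D "pipe_col D y' i"]
      next_bump_ge[of i "pipe_col D y' i" D "pipe_col D y i"]
      crosses_at_bump[OF assms(1) c(1)] crosses_at_bump[OF assms(1) c(2)] c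
    by (force simp: crosses_at_def)
  then have "y = y'"
    using pipe_col_inj[OF assms(1)] c by (auto simp: crosses_at_def)
  ultimately show ?thesis by simp
qed

text \<open>After a crossing in column \<open>j\<close>, pipe \<open>y\<close> is strictly left of
  \<open>j\<close>, and pipes never move right.\<close>

lemma crosses_at_col_inj:
  assumes "crosses_at D x y (i, j)" "crosses_at D x' y (i', j)"
  shows "i = i'"
proof -
  have *: False if "crosses_at D x y (i, j)" "crosses_at D x' y (i', j)" "i < i'" for i i' x x'
    using that pipe_col_antimono[of "Suc i" i' D y] by (auto simp: crosses_at_def)
  show ?thesis using *[of x i x' i'] *[of x' i' x i] assms by (metis nat_neq_iff)
qed

text \<open>Pipe \<open>x\<close> starts left of \<open>y\<close>, but by row \<open>s\<close> only
  \<open>y\<close> has left the grid. In a row where their order is lost,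
  \<open>row_step_mono_or_cross\<close> leaves only a crossing with \<open>x\<close>
  vertical.\<close>

lemma crossing_exists:
  assumes D: "pipe_dream D" and "x < y" "1 \<le> s" "0 < pipe_col D x s" "pipe_col D y s = 0"
  shows "\<exists>t. crosses_at D x y t"
proof -
  have "\<exists>i\<ge>1. i < s \<and> pipe_col D x i < pipe_col D y i \<and> \<not> pipe_col D x (Suc i) < pipe_col D y (Suc i)"
  proof (rule ccontr)
    assume "\<not> ?thesis"
    then have step: "pipe_col D x (Suc i) < pipe_col D y (Suc i)"
      if "1 \<le> i" "i < s" "pipe_col D x i < pipe_col D y i" for i using that by blast
    have "pipe_col D x s < pipe_col D y s"
      using \<open>1 \<le> s\<close> by (induction rule: dec_induct) (use assms(2) step in auto)
    then show False using assms by simp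
  qed
  then obtain i where i: "1 \<le> i" "i < s" "pipe_col D x i < pipe_col D y i"
    "pipe_col D y (Suc i) \<le> pipe_col D x (Suc i)" by (auto simp: not_less)
  moreover have "0 < pipe_col D x (Suc i)"
    using assms(4) pipe_col_antimono[of "Suc i" s D x] i by simp
  moreover have "1 \<le> pipe_col D x i"
    using assms(4) pipe_col_antimono[of i s D x] i by simp
  ultimately have "row_step D i (pipe_col D x i) = pipe_col D x i"
    "row_step D i (pipe_col D y i) < pipe_col D x i"
    using row_step_mono_or_cross[OF D, of "pipe_col D x i" "pipe_col D y i" i]
    by (auto simp: pipe_col_Suc)
  then have "crosses_at D x y (i, pipe_col D x i)"
    using i \<open>1 \<le> pipe_col D x i\<close> by (auto simp: crosses_at_def pipe_col_Suc row_step_eq_iff)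
  then show ?thesis by blast
qed

section \<open>Inversions of a permutation and of its inverse\<close>

lemma permutes_Icc_pos: "w permutes {1..n} \<Longrightarrow> 1 \<le> w i \<longleftrightarrow> 1 \<le> (i::nat)"
  by (metis One_nat_def atLeastAtMost_iff not_one_le_zero permutes_def permutes_in_image)

lemma inv_pos: "w permutes {1..n} \<Longrightarrow> 1 \<le> inv w i \<longleftrightarrow> 1 \<le> (i::nat)"
  by (rule permutes_Icc_pos[OF permutes_inv])

lemma permutes_inversion_bound:
  assumes "w permutes {1..n}" "i < j" "w j < w i"
  shows "j \<le> (n::nat)"
proof (rule ccontr)
  assume "\<not> j \<le> n"
  then have "w j = j" using assms(1) by (auto simp: permutes_def)
  then have "w i \<notin> {1..n}" using assms \<open>\<not> j \<le> n\<close> by auto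
  then have "w i = i" using assms(1) permutes_in_image[OF assms(1), of i] by (auto simp: permutes_def)
  then show False using assms \<open>w j = j\<close> by simp
qed

lemma Inv_inverse_eq:
  assumes "w permutes {1..n}"
  shows "Inv_inverse n w = {(x, y). 1 \<le> x \<and> x < y \<and> inv w y < inv w x}"
proof -
  have "y \<le> n" if "x < y" "inv w y < inv w x" for x y
    using permutes_inversion_bound[OF permutes_inv[OF assms] that] .
  then show ?thesis unfolding Inv_inverse_def by fastforce
qed

lemma card_inversions:
  assumes "w permutes {1..n}"
  shows "card (inversions w) = card (Inv_inverse n w)"
proof -
  note iw = permutes_inverses[OF assms]
  have "bij_betw (\<lambda>(i, j). (w j, w i)) (inversions w) (Inv_inverse n w)"
  proof (rule bij_betw_byWitness[where f' = "\<lambda>(x, y). (inv w y, inv w x)"])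
    show "(\<lambda>(i, j). (w j, w i)) ` inversions w \<subseteq> Inv_inverse n w"
    proof clarify
      fix i j assume "(i, j) \<in> inversions w"
      then have "1 \<le> j" "i < j" "w j < w i" by (auto simp: inversions_def)
      then show "(w j, w i) \<in> Inv_inverse n w"
        unfolding Inv_inverse_eq[OF assms] using permutes_Icc_pos[OF assms, of j] by (simp add: iw)
    qed
    show "(\<lambda>(x, y). (inv w y, inv w x)) ` Inv_inverse n w \<subseteq> inversions w"
    proof clarify
      fix x y assume "(x, y) \<in> Inv_inverse n w"
      then have "1 \<le> y" "x < y" "inv w y < inv w x" by (auto simp: Inv_inverse_eq[OF assms])
      then show "(inv w y, inv w x) \<in> inversions w"
        unfolding inversions_def using inv_pos[OF assms, of y] by (simp add: iw)
    qed
  qed (auto simp: iw)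
  then show ?thesis by (rule bij_betw_same_card)
qed

lemma has_permutation_pipe_col:
  assumes "w permutes {1..n}" "pipe_dream D" "has_permutation D w" "1 \<le> x"
  shows "0 < pipe_col D x (inv w x)" "pipe_col D x (Suc (inv w x)) = 0"
proof -
  have "1 \<le> inv w x" "w (inv w x) = x"
    using assms inv_pos[OF assms(1), of x] permutes_inverses[OF assms(1)] by blast+
  then show "0 < pipe_col D x (inv w x)" "pipe_col D x (Suc (inv w x)) = 0"
    using assms(3) unfolding has_permutation_iff[OF assms(2)] by metis+
qed

text \<open>Choosing one crossing per inversion is injective by \<open>crosses_at_inj\<close>. Since
  \<open>D\<close> is reduced the numbers agree, so every cross is the chosen crossing of some
  inversion.\<close>

lemma crossing_bij:
  assumes w: "w permutes {1..n}" and D: "D \<in> RPD w"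
  obtains f where "bij_betw f (Inv_inverse n w) D"
    "\<And>x y. (x, y) \<in> Inv_inverse n w \<Longrightarrow> crosses_at D x y (f (x, y))"
proof -
  have pd: "pipe_dream D" and hp: "has_permutation D w" and cd: "card D = card (Inv_inverse n w)"
    using D card_inversions[OF w] by (auto simp: RPD_def)
  have "\<exists>t. crosses_at D x y t" if "(x, y) \<in> Inv_inverse n w" for x y
  proof -
    have xy: "1 \<le> x" "x < y" "inv w y < inv w x" using that by (auto simp: Inv_inverse_eq[OF w])
    \<comment> \<open>Row \<open>s\<close> is the one just below the exit of \<open>y\<close>, and
      \<open>x\<close> exits in that row or later.\<close>
    show ?thesis
    proof (rule crossing_exists[OF pd \<open>x < y\<close>])
      show "0 < pipe_col D x (Suc (inv w y))"
        using has_permutation_pipe_col(1)[OF w pd hp xy(1)] xy(3)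
          pipe_col_antimono[of "Suc (inv w y)" "inv w x" D x] by simp
      show "pipe_col D y (Suc (inv w y)) = 0"
        using has_permutation_pipe_col(2)[OF w pd hp, of y] xy by simp
    qed simp
  qed
  then obtain g where g: "\<And>x y. (x, y) \<in> Inv_inverse n w \<Longrightarrow> crosses_at D x y (g x y)"
    by metis
  define f where "f = (\<lambda>(x, y). g x y)"
  have "inj_on f (Inv_inverse n w)"
  proof (rule inj_onI, clarify)
    fix x y x' y'
    assume "(x, y) \<in> Inv_inverse n w" "(x', y') \<in> Inv_inverse n w" "f (x, y) = f (x', y')"
    then show "x = x' \<and> y = y'" using g[of x y] g[of x' y'] crosses_at_inj[OF pd] by (simp add: f_def)
  qed
  moreover have "f ` Inv_inverse n w \<subseteq> D"
    using g by (fastforce simp: f_def crosses_at_def split: prod.splits)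
  ultimately have "bij_betw f (Inv_inverse n w) D"
    using cd pd by (metis bij_betw_def card_image card_subset_eq pipe_dream_def)
  then show ?thesis using that[of f] g by (auto simp: f_def)
qed

section \<open>Bounds for the sum of the columns of the crosses\<close>

text \<open>Each inversion contributes the rank of \<open>x\<close> among the first entries paired
  with the same \<open>y\<close>. If there are k of these, the ranks are 1 to k, with the least sum
  of k distinct positive columns. Written with ranks, the sum can be compared with that of the
  \<open>x\<close> term by term.\<close>

definition min_col_sum :: "nat \<Rightarrow> (nat \<Rightarrow> nat) \<Rightarrow> nat" where
  "min_col_sum n w = (\<Sum>(x, y)\<in>Inv_inverse n w. 1 + card {z. z < x \<and> (z, y) \<in> Inv_inverse n w})"

definition left_justified :: "(nat \<times> nat) set \<Rightarrow> bool" where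
  "left_justified D \<longleftrightarrow> (\<forall>i j m. (i, j) \<in> D \<longrightarrow> 1 \<le> m \<longrightarrow> m < j \<longrightarrow> (i, m) \<in> D)"

section \<open>Sums over finite sets of positive integers\<close>

lemma sum_rank_eq:
  fixes S :: "nat set"
  assumes "finite S"
  shows "(\<Sum>x\<in>S. 1 + card {z \<in> S. z < x}) = \<Sum>{1..card S}"
  using assms
proof (induction rule: finite_linorder_max_induct)
  case (insert b A)
  have "{z \<in> insert b A. z < x} = {z \<in> A. z < x}" if "x \<in> A" for x
    using insert.hyps that by auto
  moreover have "{z \<in> insert b A. z < b} = A" using insert.hyps by auto
  moreover have "b \<notin> A" using insert.hyps by auto
  ultimately have "(\<Sum>x\<in>insert b A. 1 + card {z \<in> insert b A. z < x})
      = 1 + card A + (\<Sum>x\<in>A. 1 + card {z \<in> A. z < x})"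
    using insert.hyps by simp
  then show ?case using insert \<open>b \<notin> A\<close> by simp
qed simp

lemma sum_positive_set_ge:
  assumes "finite T" "T \<subseteq> {1..}"
  shows "\<Sum>{1..card T} \<le> \<Sum>T"
  using assms
proof (induction rule: finite_linorder_max_induct)
  case (insert b A)
  have "insert b A \<subseteq> {1..b}"
    using insert.hyps(2) insert.prems by (force simp: less_imp_le)
  then have "card (insert b A) \<le> b" by (metis card_atLeastAtMost card_mono diff_Suc_1 finite_atLeastAtMost)
  moreover have "b \<notin> A" using insert.hyps by auto
  ultimately show ?case using insert by simp
qed simp

lemma down_closed_eq:
  assumes "finite T" "T \<subseteq> {1..}" "\<And>j m. j \<in> T \<Longrightarrow> 1 \<le> m \<Longrightarrow> m < j \<Longrightarrow> m \<in> T"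
  shows "T = {1..card T}"
proof (cases "T = {}")
  case False
  then have "T = {1..Max T}"
  proof (intro set_eqI iffI)
    fix m assume "m \<in> {1..Max T}"
    then show "m \<in> T" using assms(3)[OF Max_in[OF assms(1) False], of m] Max_in[OF assms(1) False]
      by (cases "m = Max T") auto
  qed (use assms Max_ge in auto)
  then show ?thesis by (metis card_atLeastAtMost diff_Suc_1)
qed simp

lemma sum_Inv_inverse:
  "(\<Sum>p\<in>Inv_inverse n w. h p) = (\<Sum>y\<in>{1..n}. \<Sum>x\<in>{x. (x, y) \<in> Inv_inverse n w}. h (x, y))"
proof -
  have "finite {x. (x, y) \<in> Inv_inverse n w}" for y
    by (rule finite_subset[of _ "{1..n}"]) (auto simp: Inv_inverse_def)
  then have "(\<Sum>y\<in>{1..n}. \<Sum>x\<in>{x. (x, y) \<in> Inv_inverse n w}. h (x, y))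
      = (\<Sum>(y, x)\<in>(SIGMA y:{1..n}. {x. (x, y) \<in> Inv_inverse n w}). h (x, y))"
    by (intro sum.Sigma) auto
  also have "\<dots> = (\<Sum>p\<in>Inv_inverse n w. h p)"
    by (rule sum.reindex_bij_witness[where i = prod.swap and j = prod.swap])
      (auto simp: Inv_inverse_def)
  finally show ?thesis by simp
qed

lemma min_col_sum_eq:
  "min_col_sum n w = (\<Sum>y\<in>{1..n}. \<Sum>{1..card {x. (x, y) \<in> Inv_inverse n w}})"
proof -
  have "min_col_sum n w = (\<Sum>y\<in>{1..n}. \<Sum>x\<in>{x. (x, y) \<in> Inv_inverse n w}.
      1 + card {z. z < x \<and> (z, y) \<in> Inv_inverse n w})"
    unfolding min_col_sum_def sum_Inv_inverse by simp
  also have "\<dots> = (\<Sum>y\<in>{1..n}. \<Sum>{1..card {x. (x, y) \<in> Inv_inverse n w}})"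
  proof (rule sum.cong[OF refl])
    fix y
    have "finite {x. (x, y) \<in> Inv_inverse n w}"
      by (rule finite_subset[of _ "{1..n}"]) (auto simp: Inv_inverse_def)
    from sum_rank_eq[OF this]
    show "(\<Sum>x\<in>{x. (x, y) \<in> Inv_inverse n w}. 1 + card {z. z < x \<and> (z, y) \<in> Inv_inverse n w})
        = \<Sum>{1..card {x. (x, y) \<in> Inv_inverse n w}}"
      by (simp add: conj_commute)
  qed
  finally show ?thesis .
qed

text \<open>The labels \<open>z < x\<close> split by exit row: those exiting below \<open>y\<close>
  form inversions with \<open>y\<close> and give the rank, those exiting above \<open>y\<close> are
  counted by \<open>R_stat\<close>.\<close>

lemma sum_fst_Inv_inverse:
  assumes w: "w permutes {1..n}"
  shows "(\<Sum>(x, y)\<in>Inv_inverse n w. x)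
    = min_col_sum n w + (\<Sum>(x, y)\<in>Inv_inverse n w. R_stat w x y)"
proof -
  note iw = permutes_inverses[OF w]
  have "x = 1 + card {z. z < x \<and> (z, y) \<in> Inv_inverse n w} + R_stat w x y"
    if "(x, y) \<in> Inv_inverse n w" for x y
  proof -
    have xy: "1 \<le> x" "x < y" "inv w y < inv w x" using that by (auto simp: Inv_inverse_eq[OF w])
    let ?A = "{z. z < x \<and> (z, y) \<in> Inv_inverse n w}"
    let ?B = "{z. 1 \<le> z \<and> z < x \<and> inv w z < inv w y}"
    have "bij_betw w {i. 1 \<le> i \<and> i < inv w y \<and> w i \<le> x} ?B"
    proof (rule bij_betw_byWitness[where f' = "inv w"])
      show "w ` {i. 1 \<le> i \<and> i < inv w y \<and> w i \<le> x} \<subseteq> ?B"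
      proof clarify
        fix i assume i: "1 \<le> i" "i < inv w y" "w i \<le> x"
        \<comment> \<open>Pipe \<open>x\<close> exits below \<open>y\<close>, so the bound
          \<open>w i \<le> x\<close> in \<open>R_stat\<close> amounts to a strict one.\<close>
        have "w i \<noteq> x" using i(2) xy(3) iw(2)[of i] by auto
        moreover have "1 \<le> w i" using permutes_Icc_pos[OF w, of i] i by blast
        ultimately show "1 \<le> w i \<and> w i < x \<and> inv w (w i) < inv w y" using i by (simp add: iw)
      qed
      show "inv w ` ?B \<subseteq> {i. 1 \<le> i \<and> i < inv w y \<and> w i \<le> x}"
      proof clarify
        fix z assume z: "1 \<le> z" "z < x" "inv w z < inv w y"
        then show "1 \<le> inv w z \<and> inv w z < inv w y \<and> w (inv w z) \<le> x"
          using inv_pos[OF w, of z] by (simp add: iw)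
      qed
    qed (simp_all add: iw)
    then have R: "R_stat w x y = card ?B" by (simp add: R_stat_def bij_betw_same_card)
    have "inv w z \<noteq> inv w y" if "z < x" for z using that xy iw(1) by (metis less_trans nat_neq_iff)
    then have "inv w y < inv w z" if "z < x" "\<not> inv w z < inv w y" for z
      using that by (meson nat_neq_iff)
    then have "{1..<x} = ?A \<union> ?B" "?A \<inter> ?B = {}"
      using xy by (auto simp: Inv_inverse_eq[OF w] simp del: not_less)
    moreover have "finite ?A" "finite ?B" by (auto intro: finite_subset[of _ "{..<x}"])
    ultimately have "card {1..<x} = card ?A + card ?B" by (simp add: card_Un_disjoint)
    then show ?thesis using R xy(1) by simp
  qed
  then show ?thesis
    unfolding min_col_sum_def sum.distrib[symmetric] by (intro sum.cong) auto
qed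

lemma col_sum_bounds:
  assumes w: "w permutes {1..n}" and D: "D \<in> RPD w"
  shows "sum snd D \<le> (\<Sum>(x, y)\<in>Inv_inverse n w. x)" (is ?upper)
    and "min_col_sum n w \<le> sum snd D" (is ?lower)
    and "left_justified D \<Longrightarrow> sum snd D = min_col_sum n w"
proof -
  have pd: "pipe_dream D" using D by (simp add: RPD_def)
  obtain f where bij: "bij_betw f (Inv_inverse n w) D"
    and f: "\<And>x y. (x, y) \<in> Inv_inverse n w \<Longrightarrow> crosses_at D x y (f (x, y))"
    using crossing_bij[OF w D] by blast
  define c where "c = (\<lambda>x y. snd (f (x, y)))"
  define A where "A = (\<lambda>y. {x. (x, y) \<in> Inv_inverse n w})"
  have c: "\<exists>i. f (x, y) = (i, c x y) \<and> crosses_at D x y (i, c x y)" if "x \<in> A y" for x y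
    using f[of x y] that by (auto simp: c_def A_def intro: exI[of _ "fst (f (x, y))"])
  have sum_eq: "sum snd D = (\<Sum>p\<in>Inv_inverse n w. snd (f p))"
    using sum.reindex_bij_betw[OF bij, of snd] by simp
  show ?upper unfolding sum_eq
  proof (rule sum_mono, clarify)
    fix x y assume "(x, y) \<in> Inv_inverse n w"
    then obtain i where "f (x, y) = (i, c x y)" "crosses_at D x y (i, c x y)"
      using c[of x y] by (auto simp: A_def)
    then show "snd (f (x, y)) \<le> x"
      using pipe_col_le[of D x i] by (simp add: crosses_at_def)
  qed
  have fin: "finite (A y)" for y
    by (rule finite_subset[of _ "{1..n}"]) (auto simp: Inv_inverse_def A_def)
  have inj: "inj_on (\<lambda>x. c x y) (A y)" for y
  proof (rule inj_onI)
    fix x x' assume "x \<in> A y" "x' \<in> A y" "c x y = c x' y"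
    then show "x = x'"
      using c[of x y] c[of x' y] crosses_at_col_inj crosses_at_inj[OF pd] by metis
  qed
  have sum_T: "sum snd D = (\<Sum>y\<in>{1..n}. \<Sum>((\<lambda>x. c x y) ` A y))"
    unfolding sum_eq sum_Inv_inverse using inj by (simp add: sum.reindex A_def c_def)
  have card_T: "card ((\<lambda>x. c x y) ` A y) = card (A y)" for y
    using inj by (rule card_image)
  have pos: "(\<lambda>x. c x y) ` A y \<subseteq> {1..}" for y
    using c crosses_at_row[OF pd] by fastforce
  show ?lower unfolding sum_T min_col_sum_eq
  proof (rule sum_mono)
    fix y
    show "\<Sum>{1..card {x. (x, y) \<in> Inv_inverse n w}} \<le> \<Sum>((\<lambda>x. c x y) ` A y)"
      using sum_positive_set_ge[OF _ pos, of y] fin card_T by (simp add: A_def)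
  qed
  assume lj: "left_justified D"
  show "sum snd D = min_col_sum n w" unfolding sum_T min_col_sum_eq
  proof (rule sum.cong[OF refl])
    fix y
    have "(\<lambda>x. c x y) ` A y = {1..card ((\<lambda>x. c x y) ` A y)}"
    proof (rule down_closed_eq[OF finite_imageI[OF fin] pos])
      fix j m assume "j \<in> (\<lambda>x. c x y) ` A y" and m: "1 \<le> m" "m < j"
      then obtain i x where x: "crosses_at D x y (i, j)" using c by blast
      then have "(i, m) \<in> D" using lj m by (auto simp: left_justified_def crosses_at_def)
      then obtain x' y' where xy': "(x', y') \<in> Inv_inverse n w" "f (x', y') = (i, m)"
        using bij unfolding bij_betw_def by (metis imageE surj_pair)
      then have cr: "crosses_at D x' y' (i, m)" using f by metis
      \<comment> \<open>In a left-justified row only crosses lie left of the cross at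
        \<open>j\<close>, so \<open>y\<close> runs to the left boundary and passes
        \<open>(i, m)\<close> horizontally.\<close>
      have "next_bump D i (pipe_col D y i) < m"
      proof (rule ccontr)
        let ?b = "next_bump D i (pipe_col D y i)"
        assume "\<not> ?b < m"
        then have "1 \<le> ?b" "?b < j"
          using m x crosses_at_bump[OF pd x] by (auto simp: crosses_at_def)
        then have "(i, ?b) \<in> D" using lj x by (auto simp: left_justified_def crosses_at_def)
        then show False using next_bump_notin[OF pd] by metis
      qed
      then have "crosses_at D x' y (i, m)"
        using cr x m crosses_at_bump(2)[OF pd x] by (auto simp: crosses_at_def)
      then have "y' = y" using cr crosses_at_inj[OF pd] by blast
      then show "m \<in> (\<lambda>x. c x y) ` A y"
        using xy' by (auto simp: A_def c_def intro!: image_eqI[of _ _ x'])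
    qed
    then show "\<Sum>((\<lambda>x. c x y) ` A y) = \<Sum>{1..card {x. (x, y) \<in> Inv_inverse n w}}"
      unfolding card_T by (simp add: A_def)
  qed
qed

section \<open>Inverse simple ladder moves\<close>

lemma next_bump_cong:
  "(\<And>m. m < a \<Longrightarrow> (r, m) \<in> D \<longleftrightarrow> (r, m) \<in> D') \<Longrightarrow> next_bump D r a = next_bump D' r a"
  by (induction a) auto

lemma row_step_cong:
  "(\<And>m. (r, m) \<in> D \<longleftrightarrow> (r, m) \<in> D') \<Longrightarrow> row_step D r a = row_step D' r a"
  using next_bump_cong[of a r D D'] by (simp add: row_step_def)

text \<open>A simple inverse ladder move between rows \<open>h\<close> and \<open>i\<close> swaps the columns \<open>j\<close> and \<open>j + 1\<close>
  of all pipes strictly between these two rows, and changes nothing else.\<close>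

locale inverse_ladder =
  fixes D D' :: "(nat \<times> nat) set" and h i j :: nat
  assumes pipe_dream: "pipe_dream D"
    and D': "D' = insert (i, j) (D - {(h, Suc j)})"
    and hi: "h < i" and j: "1 \<le> j"
    and corners: "(h, j) \<notin> D" "(h, Suc j) \<in> D" "(i, j) \<notin> D" "(i, Suc j) \<notin> D"
    and between: "\<And>r. h < r \<Longrightarrow> r < i \<Longrightarrow> (r, j) \<in> D \<and> (r, Suc j) \<in> D"
begin

abbreviation "swap \<equiv> Transposition.transpose j (Suc j)"

lemma h_pos: "1 \<le> h"
  using corners(2) pipe_dream_zero(2)[OF pipe_dream] by (cases h) auto

lemma pipe_dream': "pipe_dream D'"
  using pipe_dream D' hi j by (auto simp: pipe_dream_def)

lemma swap_other: "a \<noteq> j \<Longrightarrow> a \<noteq> Suc j \<Longrightarrow> swap a = a"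
  by (simp add: transpose_def)

lemma low_cong: "a \<le> j \<Longrightarrow> next_bump D' r a = next_bump D r a"
  by (rule next_bump_cong) (auto simp: D')

text \<open>In \<open>D\<close> the pipe entering at \<open>Suc j\<close> goes straight and the one
  arriving from the right turns down at \<open>j\<close>. With the cross removed, the former turns
  down at \<open>j\<close> and the latter at \<open>Suc j\<close>.\<close>

lemma row_step_top: "row_step D' h a = swap (row_step D h a)"
proof -
  have beyond: "next_bump D' h a = swap (next_bump D h a)" if "Suc (Suc j) \<le> a" for a
    using that
  proof (induction a rule: dec_induct)
    case base
    show ?case using corners hi by (simp add: D')
  next
    case (step a)
    then have "swap a = a" by (intro swap_other) auto
    then show ?case using step hi by (auto simp: D')
  qed
  consider "a \<le> j" | "a = Suc j" | "Suc (Suc j) \<le> a" by linarith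
  then show ?thesis
  proof cases
    case 1
    then have "row_step D' h a = row_step D h a"
      using low_cong[of a h] hi by (auto simp: row_step_def D')
    moreover have "row_step D h a < j"
      using 1 corners(1) row_step_le[of D h a] next_bump_less[OF j, of D h]
      by (cases "a = j") (auto simp: row_step_def le_less)
    ultimately show ?thesis using swap_other by simp
  next
    case 2
    then show ?thesis using corners hi by (simp add: row_step_def D')
  next
    case 3
    then have "swap a = a" by (intro swap_other) auto
    then show ?thesis using 3 beyond hi by (auto simp: row_step_def D')
  qed
qed

lemma row_step_between:
  assumes "h < r" "r < i"
  shows "row_step D' r (swap a) = swap (row_step D r a)"
proof -
  have "row_step D' r (swap a) = row_step D r (swap a)"
    by (rule row_step_cong) (use assms in \<open>auto simp: D'\<close>)
  also have "\<dots> = swap (row_step D r a)"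
  proof (cases "a = j \<or> a = Suc j")
    case True
    then show ?thesis using between[OF assms] by (auto simp: row_step_def)
  next
    case False
    have "next_bump D r a \<noteq> j" "next_bump D r a \<noteq> Suc j"
      using between[OF assms] next_bump_notin[OF pipe_dream, of r a] by metis+
    then show ?thesis using False swap_other by (auto simp: row_step_def)
  qed
  finally show ?thesis .
qed

text \<open>In \<open>D\<close> the pipe at \<open>Suc j\<close> ends in column \<open>j\<close> and
  the pipe at \<open>j\<close> goes on to the left. In \<open>D'\<close> they enter interchanged,
  and at the new cross the former goes straight down and the latter straight left.\<close>

lemma row_step_bottom: "row_step D' i (swap a) = row_step D i a"
proof -
  have beyond: "next_bump D' i a = next_bump D i a" if "Suc (Suc j) \<le> a" for a
    using that
  proof (induction a rule: dec_induct)
    case base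
    show ?case using corners hi by (simp add: D')
  next
    case (step a)
    then show ?case using hi by (auto simp: D')
  qed
  consider "a < j" | "a = j" | "a = Suc j" | "Suc (Suc j) \<le> a" by linarith
  then show ?thesis
  proof cases
    case 1
    then show ?thesis using low_cong[of a i] swap_other hi by (auto simp: row_step_def D')
  next
    case 2
    then show ?thesis using corners hi low_cong[of j i] by (auto simp: row_step_def D')
  next
    case 3
    then show ?thesis using corners hi by (auto simp: row_step_def D')
  next
    case 4
    then have "swap a = a" by (intro swap_other) auto
    then show ?thesis using 4 beyond hi by (auto simp: row_step_def D')
  qed
qed

lemma pipe_col_eq:
  assumes "1 \<le> r"
  shows "pipe_col D' x r = (if h < r \<and> r \<le> i then swap (pipe_col D x r) else pipe_col D x r)"
  using assms
proof (induction r rule: dec_induct)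
  case base
  then show ?case using h_pos by simp
next
  case (step r)
  have s: "pipe_col E x (Suc r) = row_step E r (pipe_col E x r)" for E
    using step.hyps by (simp add: pipe_col_Suc)
  consider "r = h" | "h < r" "r < i" | "r = i" | "r < h \<or> i < r" by linarith
  then show ?case
  proof cases
    case 1
    then show ?thesis using s step.IH row_step_top hi by simp
  next
    case 2
    then show ?thesis using s step.IH row_step_between by simp
  next
    case 3
    then show ?thesis using s step.IH row_step_bottom hi by simp
  next
    case 4
    then have "row_step D' r a = row_step D r a" for a
      using hi by (intro row_step_cong) (auto simp: D')
    then show ?thesis using 4 s step.IH hi by auto
  qed
qed

text \<open>\<open>swap\<close> fixes 0 because \<open>1 \<le> j\<close>, so every pipe leaves in
  the same row as before.\<close>

lemma has_permutation_iff': "has_permutation D' w \<longleftrightarrow> has_permutation D w"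
proof -
  have "swap a = 0 \<longleftrightarrow> a = 0" for a
    using j by (auto simp: transpose_def)
  then have "pipe_col D' x r = 0 \<longleftrightarrow> pipe_col D x r = 0" if "1 \<le> r" for x r
    using pipe_col_eq[OF that] by simp
  then have "0 < pipe_col D' (w r) r \<and> pipe_col D' (w r) (Suc r) = 0 \<longleftrightarrow>
      0 < pipe_col D (w r) r \<and> pipe_col D (w r) (Suc r) = 0" if "1 \<le> r" for r
    using that by (metis le_Suc_eq neq0_conv)
  then show ?thesis
    unfolding has_permutation_iff[OF pipe_dream] has_permutation_iff[OF pipe_dream'] by blast
qed

lemma finite_D: "finite D"
  using pipe_dream by (simp add: pipe_dream_def)

lemma RPD_D':
  assumes "D \<in> RPD w" shows "D' \<in> RPD w"
proof -
  have "card D' = card D"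
    using corners hi finite_D card_Suc_Diff1[OF finite_D corners(2)] by (simp add: D')
  then show ?thesis
    using assms has_permutation_iff' pipe_dream' by (simp add: RPD_def)
qed

lemma ladder_move_D': "ladder_move D' D"
proof -
  have "ladder_movable D' i j h (Suc j)"
    unfolding ladder_movable_def
  proof (intro conjI subsetI)
    fix t assume t: "t \<in> {h..i} \<times> {j..Suc j} - {(h, j), (i, Suc j), (h, Suc j)}"
    then obtain r c where rc: "t = (r, c)" "h \<le> r" "r \<le> i" "c = j \<or> c = Suc j"
      by fastforce
    then show "t \<in> D'"
      using t between[of r] by (cases "r = h"; cases "r = i") (auto simp: D')
  qed (use corners hi h_pos j in \<open>auto simp: D'\<close>)
  moreover have "D = insert (h, Suc j) (D' - {(i, j)})"
    using corners hi by (auto simp: D')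
  ultimately show ?thesis unfolding ladder_move_def by blast
qed

lemma col_sum_D': "sum snd D = Suc (sum snd D')"
  using corners hi finite_D sum.remove[OF finite_D corners(2), of snd] by (simp add: D')

end

text \<open>In the lowest row \<open>h\<close> with a bump directly left of a cross, the two pipes of that cross run down
  columns \<open>j\<close> and \<open>j + 1\<close> to the next row \<open>i\<close> not having two crosses there. A cross at \<open>(i, j)\<close>
  would be a second crossing of these two pipes, so both tiles in row \<open>i\<close> are bumps.\<close>

lemma inverse_ladder_exists:
  assumes w: "w permutes {1..n}" and D: "D \<in> RPD w" and nlj: "\<not> left_justified D"
  shows "\<exists>D' h i j. inverse_ladder D D' h i j"
proof -
  have pd: "pipe_dream D" and fin: "finite D" using D by (auto simp: RPD_def pipe_dream_def)
  define H where "H = {h. \<exists>j\<ge>1. (h, j) \<notin> D \<and> (h, Suc j) \<in> D}"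
  have "H \<noteq> {}"
  proof
    assume "H = {}"
    then have step: "(i, j) \<in> D" if "(i, Suc j) \<in> D" "1 \<le> j" for i j
      using that by (auto simp: H_def)
    have "(i, m) \<in> D" if "(i, j) \<in> D" "1 \<le> m" "m \<le> j" for i j m
      using that(3) by (induction rule: inc_induct) (use that step in auto)
    then have "left_justified D" by (auto simp: left_justified_def)
    then show False using nlj by simp
  qed
  moreover have "finite H"
    by (rule finite_subset[of _ "fst ` D"]) (use fin in \<open>force simp: H_def\<close>)+
  ultimately have "Max H \<in> H" and max: "\<And>r. r \<in> H \<Longrightarrow> r \<le> Max H" by auto
  define h where "h = Max H"
  obtain j where j: "1 \<le> j" "(h, j) \<notin> D" "(h, Suc j) \<in> D"
    using \<open>Max H \<in> H\<close> by (auto simp: H_def h_def)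
  have "\<exists>i>h. \<not> ((i, j) \<in> D \<and> (i, Suc j) \<in> D)"
  proof (rule ccontr)
    assume "\<not> ?thesis"
    then have "(\<lambda>i. (i, j)) ` {h<..} \<subseteq> D" by auto
    then have "finite ((\<lambda>i. (i, j)) ` {h<..})" using fin finite_subset by blast
    moreover have "inj_on (\<lambda>i. (i, j)) {h<..}" by (auto intro: inj_onI)
    ultimately show False using finite_imageD infinite_Ioi by blast
  qed
  then obtain i where i: "h < i" "\<not> ((i, j) \<in> D \<and> (i, Suc j) \<in> D)"
    and min: "\<And>r. h < r \<Longrightarrow> r < i \<Longrightarrow> (r, j) \<in> D \<and> (r, Suc j) \<in> D"
    using exists_least_iff[of "\<lambda>i. h < i \<and> \<not> ((i, j) \<in> D \<and> (i, Suc j) \<in> D)"] by blast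
  \<comment> \<open>A cross here would have a bump to its left and put \<open>i\<close> into
    \<open>H\<close>, although \<open>h\<close> is the largest row in \<open>H\<close>.\<close>
  have "(i, Suc j) \<notin> D"
    using i max[of i] j(1) by (auto simp: H_def h_def)
  moreover have "(i, j) \<notin> D"
  proof
    assume ij: "(i, j) \<in> D"
    obtain f where bij: "bij_betw f (Inv_inverse n w) D"
      and f: "\<And>x y. (x, y) \<in> Inv_inverse n w \<Longrightarrow> crosses_at D x y (f (x, y))"
      using crossing_bij[OF w D] by blast
    have ex: "\<exists>x y. (x, y) \<in> Inv_inverse n w \<and> crosses_at D x y t" if "t \<in> D" for t
      using that bij f unfolding bij_betw_def by (metis imageE surj_pair)
    obtain x y where xy: "(x, y) \<in> Inv_inverse n w" "crosses_at D x y (h, Suc j)"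
      using ex[OF j(3)] by blast
    obtain x' y' where xy': "(x', y') \<in> Inv_inverse n w" "crosses_at D x' y' (i, j)"
      using ex[OF ij] by blast
    have h: "1 \<le> h" using crosses_at_row[OF pd xy(2)] by simp
    have x1: "pipe_col D x (Suc h) = Suc j"
      using xy(2) j h by (simp add: crosses_at_def pipe_col_Suc row_step_def)
    have y1: "pipe_col D y (Suc h) = j"
      using crosses_at_bump(2)[OF pd xy(2)] xy(2) next_bump_ge[OF j(2), of "pipe_col D y h"]
      by (auto simp: crosses_at_def)
    have "pipe_col D x i = Suc j \<and> pipe_col D y i = j"
      using Suc_leI[OF i(1)]
    proof (induction rule: dec_induct)
      case (step r)
      then show ?case using min[of r] by (simp add: pipe_col_Suc row_step_def)
    qed (use x1 y1 in simp)
    moreover have "pipe_col D x (Suc i) < j"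
      using calculation \<open>(i, Suc j) \<notin> D\<close> ij i(1) next_bump_less[OF j(1)]
      by (simp add: pipe_col_Suc row_step_def)
    \<comment> \<open>Here \<open>y\<close> is vertical and \<open>x\<close> horizontal, but every
      cross carries an inversion whose smaller label is vertical.\<close>
    ultimately have "crosses_at D y x (i, j)"
      using ij by (simp add: crosses_at_def)
    then have "(y, x) \<in> Inv_inverse n w" using xy' crosses_at_inj[OF pd] by blast
    then show False using xy(1) by (simp add: Inv_inverse_eq[OF w])
  qed
  ultimately have "inverse_ladder D (insert (i, j) (D - {(h, Suc j)})) h i j"
    by unfold_locales (use pd j i min in auto)
  then show ?thesis by blast
qed

section \<open>The top-justified pipe dream\<close>

text \<open>The Lehmer code of \<open>inv w\<close>. Its entries are the column heights of the
  top-justified pipe dream.\<close>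

definition inv_code :: "(nat \<Rightarrow> nat) \<Rightarrow> nat \<Rightarrow> nat" where
  "inv_code w x = card {y. x < y \<and> inv w y < inv w x}"

definition top_pipe_dream :: "(nat \<Rightarrow> nat) \<Rightarrow> (nat \<times> nat) set" where
  "top_pipe_dream w = {(i, x). 1 \<le> i \<and> 1 \<le> x \<and> i \<le> inv_code w x}"

section \<open>Every column of every row is reached by some pipe\<close>

lemma next_bump_right:
  fixes b r :: nat
  assumes "finite D"
  obtains c where "b < c" "(r, c) \<notin> D" "\<And>m. b < m \<Longrightarrow> m < c \<Longrightarrow> (r, m) \<in> D"
proof -
  have "\<exists>c>b. (r, c) \<notin> D"
  proof (rule ccontr)
    assume "\<not> ?thesis"
    then have "Pair r ` {b<..} \<subseteq> D" by auto
    then have "finite (Pair r ` {b<..})" using assms finite_subset by blast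
    then show False using finite_imageD[of "Pair r" "{b<..}"] infinite_Ioi[of b]
      by (simp add: inj_on_def)
  qed
  then show ?thesis
    using that exists_least_iff[of "\<lambda>c. b < c \<and> (r, c) \<notin> D"] by blast
qed

text \<open>Run the row backwards: a pipe leaves it in column \<open>b\<close> either straight
  through a cross or after turning at the first bump right of \<open>b\<close>.\<close>

lemma row_step_surj:
  assumes "pipe_dream D"
  shows "\<exists>a\<ge>b. row_step D r a = b"
proof (cases "(r, b) \<in> D")
  case True
  then show ?thesis by (auto simp: row_step_def)
next
  case False
  obtain c where c: "b < c" "(r, c) \<notin> D" "\<And>m. b < m \<Longrightarrow> m < c \<Longrightarrow> (r, m) \<in> D"
    using next_bump_right assms unfolding pipe_dream_def by blast
  then have "row_step D r c = b"
    using next_bump_eqI[OF assms False] by (simp add: row_step_def)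
  then show ?thesis using c(1) less_imp_le by blast
qed

lemma pipe_col_surj:
  assumes "pipe_dream D" "1 \<le> r"
  shows "\<exists>x. pipe_col D x r = b"
  using assms(2)
proof (induction r arbitrary: b rule: dec_induct)
  case (step r)
  obtain a where "row_step D r a = b" using row_step_surj[OF assms(1)] by blast
  moreover obtain x where "pipe_col D x r = a" using step.IH by blast
  ultimately show ?case using step.hyps by (auto simp: pipe_col_Suc)
qed simp

section \<open>Tracing the pipes of the top-justified pipe dream\<close>

locale top_dream =
  fixes n :: nat and w :: "nat \<Rightarrow> nat"
  assumes w: "w permutes {1..n}"
begin

abbreviation "D \<equiv> top_pipe_dream w"

abbreviation "exit_row \<equiv> inv w"

text \<open>Column \<open>x\<close> has \<open>inv_code w x\<close> crosses, as many as there are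
  inversions with first entry \<open>x\<close>. The weights 1 and \<open>x\<close> yield the size
  and the column sum.\<close>

lemma sum_snd_top:
  "(\<Sum>(i, x)\<in>D. h x) = (\<Sum>(x, y)\<in>Inv_inverse n w. h x :: nat)"
proof -
  have fin: "finite {y. x < y \<and> exit_row y < exit_row x}" for x
    by (rule finite_subset[of _ "{..n}"])
      (auto dest: permutes_inversion_bound[OF permutes_inv[OF w]])
  have le_n: "x \<le> n" if "x < y" "exit_row y < exit_row x" for x y
    using permutes_inversion_bound[OF permutes_inv[OF w] that] that by simp
  have "1 \<le> inv_code w x \<Longrightarrow> x \<le> n" for x
    using le_n by (auto simp: inv_code_def card_gt_0_iff Suc_le_eq)
  then have le_n': "x \<le> n" if "1 \<le> i" "i \<le> inv_code w x" for i x
    using that order_trans by blast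
  have "(\<Sum>(i, x)\<in>D. h x) = (\<Sum>(x, i)\<in>(SIGMA x:{1..n}. {1..inv_code w x}). h x)"
    by (rule sum.reindex_bij_witness[where i = prod.swap and j = prod.swap])
      (auto simp: top_pipe_dream_def le_n')
  also have "\<dots> = (\<Sum>x\<in>{1..n}. inv_code w x * h x)"
    by (subst sum.Sigma[symmetric]) auto
  also have "\<dots> = (\<Sum>(x, y)\<in>(SIGMA x:{1..n}. {y. x < y \<and> exit_row y < exit_row x}). h x)"
    by (subst sum.Sigma[symmetric]) (auto simp: inv_code_def fin)
  also have "(SIGMA x:{1..n}. {y. x < y \<and> exit_row y < exit_row x}) = Inv_inverse n w"
    using le_n by (auto simp: Inv_inverse_eq[OF w])
  finally show ?thesis .
qed

lemma pipe_dream_top: "pipe_dream D"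
proof -
  have "D \<subseteq> (\<lambda>(x, i). (i, x)) ` (SIGMA x:{1..n}. {1..inv_code w x})"
  proof clarify
    fix i x assume "(i, x) \<in> D"
    then have ix: "1 \<le> i" "1 \<le> x" "i \<le> inv_code w x" by (auto simp: top_pipe_dream_def)
    then have "{y. x < y \<and> exit_row y < exit_row x} \<noteq> {}"
      by (metis inv_code_def card.empty not_one_le_zero order_trans)
    then obtain y where "x < y" "exit_row y < exit_row x" by blast
    then have "x \<le> n" using permutes_inversion_bound[OF permutes_inv[OF w], of x y] by simp
    then show "(i, x) \<in> (\<lambda>(x, i). (i, x)) ` (SIGMA x:{1..n}. {1..inv_code w x})"
      using ix by (auto intro!: image_eqI[of _ _ "(x, i)"])
  qed
  then have "finite D" by (rule finite_subset) auto
  then show ?thesis by (auto simp: pipe_dream_def top_pipe_dream_def)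
qed

text \<open>The pipes that still have to be crossed by pipe \<open>x\<close> from row \<open>r\<close> on. In terms of the
  sequence of exit rows read along row \<open>r\<close>, going down one row is a pass of bubble sort, which
  lowers each nonzero entry of the code by one.\<close>

definition later_crossings :: "nat \<Rightarrow> nat \<Rightarrow> nat set" where
  "later_crossings r x = {y. pipe_col D x r < pipe_col D y r \<and> exit_row y < exit_row x}"

text \<open>\<open>inv_code w c - (r - 1)\<close> is the number of crosses in column
  \<open>c\<close> from row \<open>r\<close> on; truncation gives 0 for exhausted columns. The first
  clause says that every pipe exits in its intended row as far as row \<open>r\<close> can
  tell.\<close>

definition code_invariant :: "nat \<Rightarrow> bool" where
  "code_invariant r \<longleftrightarrow> (\<forall>x\<ge>1. 0 < pipe_col D x r \<longleftrightarrow> r \<le> exit_row x) \<and>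
     (\<forall>x. 0 < pipe_col D x r \<longrightarrow>
        inv_code w (pipe_col D x r) - (r - 1) = card (later_crossings r x))"

lemma exit_row_w: "exit_row (w i) = i" "w (exit_row i) = i"
  using permutes_inverses[OF w] by simp_all

lemma exit_row_inj: "exit_row x = exit_row y \<Longrightarrow> x = y"
  by (metis exit_row_w(2))

lemma finite_later_crossings: "finite (later_crossings r x)"
proof (rule finite_subset)
  show "later_crossings r x \<subseteq> w ` {..<exit_row x}"
    by (auto simp: later_crossings_def exit_row_w(2) intro!: image_eqI[of _ w "exit_row _"])
qed simp

lemma later_crossings_empty:
  "later_crossings r x = {} \<Longrightarrow> pipe_col D x r < pipe_col D y r \<Longrightarrow> exit_row x \<le> exit_row y"
  unfolding later_crossings_def using not_less by blast

lemma pipe_pos: "0 < pipe_col D x r \<Longrightarrow> 1 \<le> x"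
  using pipe_col_le[of D x r] by simp

lemma cross_iff:
  assumes "code_invariant r" "1 \<le> r" "0 < pipe_col D x r"
  shows "(r, pipe_col D x r) \<in> D \<longleftrightarrow> later_crossings r x \<noteq> {}"
proof -
  have "card (later_crossings r x) = inv_code w (pipe_col D x r) - (r - 1)"
    using assms by (simp add: code_invariant_def)
  moreover have "later_crossings r x \<noteq> {} \<longleftrightarrow> 0 < card (later_crossings r x)"
    using finite_later_crossings by (simp add: card_gt_0_iff)
  ultimately show ?thesis
    using assms by (auto simp: top_pipe_dream_def)
qed

text \<open>Take the pipe with the earliest exit at or right of \<open>y\<close>: nothing further
  right exits before it.\<close>

lemma bump_to_the_right:
  obtains z where "later_crossings r z = {}" "pipe_col D y r \<le> pipe_col D z r" "exit_row z \<le> exit_row y"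
proof -
  obtain z where z: "pipe_col D y r \<le> pipe_col D z r"
    and min: "\<And>u. pipe_col D y r \<le> pipe_col D u r \<Longrightarrow> exit_row z \<le> exit_row u"
    using ex_has_least_nat[of "\<lambda>z. pipe_col D y r \<le> pipe_col D z r" y exit_row] by blast
  have "later_crossings r z = {}"
  proof (rule ccontr)
    assume "later_crossings r z \<noteq> {}"
    then obtain u where "pipe_col D z r < pipe_col D u r" "exit_row u < exit_row z"
      by (auto simp: later_crossings_def)
    then show False using z min[of u] by simp
  qed
  then show ?thesis using that z min by blast
qed

text \<open>Pipe \<open>x\<close> turns at a bump and sweeps past \<open>y\<close>. The pipe
  \<open>z\<close> stands on a bump at or right of \<open>y\<close>, hence not left of
  \<open>x\<close>. As \<open>x\<close> has no crossings left, it exits no later than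
  \<open>z\<close>, and so no later than \<open>y\<close>.\<close>

lemma exit_row_less_between:
  assumes "code_invariant r" "1 \<le> r" "0 < pipe_col D x r" "later_crossings r x = {}"
    "next_bump D r (pipe_col D x r) < pipe_col D y r" "pipe_col D y r < pipe_col D x r"
  shows "exit_row x < exit_row y"
proof -
  obtain z where z: "later_crossings r z = {}" "pipe_col D y r \<le> pipe_col D z r"
    "exit_row z \<le> exit_row y" by (rule bump_to_the_right)
  have "(r, pipe_col D z r) \<notin> D" using cross_iff[OF assms(1,2), of z] z assms by simp
  then have "pipe_col D x r \<le> pipe_col D z r"
    using between_next_bump[of D r "pipe_col D x r" "pipe_col D z r"] assms z by force
  moreover have "exit_row x \<le> exit_row z" if "pipe_col D x r < pipe_col D z r"
    using that assms(4) later_crossings_empty by blast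
  moreover have "x = z" if "pipe_col D x r = pipe_col D z r"
    using pipe_col_inj[OF pipe_dream_top that assms(3)] .
  ultimately have "exit_row x \<le> exit_row y" using z(3) by (metis le_neq_implies_less order_trans order_refl)
  moreover have "exit_row x \<noteq> exit_row y" using exit_row_inj assms(6) by blast
  ultimately show ?thesis by simp
qed

text \<open>If \<open>x\<close> runs to the boundary, it exits no later than any pipe that it passes
  or has on its right, so no later than \<open>w r\<close>. Conversely, if \<open>x\<close> is due
  in row \<open>r\<close>, no earlier exit is left to cross, and a pipe at a bump stopping
  \<open>x\<close> would still have to cross \<open>x\<close>.\<close>

lemma exits_iff:
  assumes I: "code_invariant r" and r: "1 \<le> r" and x: "0 < pipe_col D x r"
  shows "pipe_col D x (Suc r) = 0 \<longleftrightarrow> exit_row x = r"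
proof
  have rx: "r \<le> exit_row x" using I x pipe_pos[OF x] by (simp add: code_invariant_def)
  {
    assume "pipe_col D x (Suc r) = 0"
    then have s: "(r, pipe_col D x r) \<notin> D" "next_bump D r (pipe_col D x r) = 0"
      using r x by (auto simp: pipe_col_Suc row_step_def split: if_splits)
    then have K: "later_crossings r x = {}" using cross_iff[OF I r x] by simp
    have "1 \<le> w r" using permutes_Icc_pos[OF w] r by blast
    then have "0 < pipe_col D (w r) r"
      using I by (simp add: code_invariant_def exit_row_w)
    then have "exit_row x \<le> exit_row (w r)"
      using exit_row_less_between[OF I r x K, of "w r"] s K
        pipe_col_inj[OF pipe_dream_top, of x r "w r"] x later_crossings_empty[OF K, of "w r"]
        \<open>0 < pipe_col D (w r) r\<close>
      by (cases "pipe_col D x r" "pipe_col D (w r) r" rule: linorder_cases) auto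
    then show "exit_row x = r" using rx by (simp add: exit_row_w)
  next
    assume xr: "exit_row x = r"
    have "later_crossings r x = {}"
    proof (rule ccontr)
      assume "later_crossings r x \<noteq> {}"
      then obtain y where "pipe_col D x r < pipe_col D y r" "exit_row y < r"
        using xr by (auto simp: later_crossings_def)
      then have y: "0 < pipe_col D y r" "exit_row y < r" by simp_all
      then show False using I pipe_pos[OF y(1)] by (auto simp: code_invariant_def)
    qed
    then have s: "pipe_col D x (Suc r) = next_bump D r (pipe_col D x r)"
      using cross_iff[OF I r x] r by (simp add: pipe_col_Suc row_step_def)
    show "pipe_col D x (Suc r) = 0"
    proof (rule ccontr)
      assume b: "pipe_col D x (Suc r) \<noteq> 0"
      obtain y where y: "pipe_col D y r = next_bump D r (pipe_col D x r)"
        using pipe_col_surj[OF pipe_dream_top r] by blast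
      then have y0: "0 < pipe_col D y r" using b s by simp
      then have "later_crossings r y = {}"
        using cross_iff[OF I r y0] next_bump_notin[OF pipe_dream_top, of r] y by metis
      moreover have "pipe_col D y r < pipe_col D x r"
        using y next_bump_less[of "pipe_col D x r" D r] x by simp
      moreover have "r \<le> exit_row y"
        using I y0 pipe_pos[OF y0] by (simp add: code_invariant_def)
      moreover have "exit_row y \<noteq> exit_row x"
        using exit_row_inj calculation(2) by blast
      ultimately show False using xr by (auto simp: later_crossings_def)
    qed
  }
qed

text \<open>Only \<open>z\<close>, the pipe at the first bump right of \<open>x\<close>, passes
  \<open>x\<close>, since that bump stops all pipes beyond it. It has to be crossed because it exits
  no later than \<open>z'\<close>, hence no later than some \<open>y\<close> that \<open>x\<close>
  must cross.\<close>

lemma later_crossings_Suc_cross: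
  assumes I: "code_invariant r" and r: "1 \<le> r" and x: "0 < pipe_col D x r"
    and cross: "(r, pipe_col D x r) \<in> D"
  shows "card (later_crossings (Suc r) x) = card (later_crossings r x) - 1"
proof -
  let ?a = "pipe_col D x r"
  have a: "pipe_col D x (Suc r) = ?a" using cross r by (simp add: pipe_col_Suc row_step_def)
  obtain c where c: "?a < c" "(r, c) \<notin> D" "\<And>m. ?a < m \<Longrightarrow> m < c \<Longrightarrow> (r, m) \<in> D"
    using next_bump_right pipe_dream_top unfolding pipe_dream_def by blast
  obtain z where z: "pipe_col D z r = c" using pipe_col_surj[OF pipe_dream_top r] by blast
  have Kz: "later_crossings r z = {}" using cross_iff[OF I r, of z] z c by simp
  obtain y where y: "?a < pipe_col D y r" "exit_row y < exit_row x"
    using cross_iff[OF I r x] cross by (auto simp: later_crossings_def)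
  obtain z' where z': "later_crossings r z' = {}" "pipe_col D y r \<le> pipe_col D z' r"
    "exit_row z' \<le> exit_row y" by (rule bump_to_the_right)
  have "(r, pipe_col D z' r) \<notin> D" using cross_iff[OF I r, of z'] z' y by simp
  then have "c \<le> pipe_col D z' r" using c(3)[of "pipe_col D z' r"] z' y by force
  then have "exit_row z \<le> exit_row z'"
    using later_crossings_empty[OF Kz, of z'] z pipe_col_inj[OF pipe_dream_top, of z r z'] c(1)
    by (cases "c = pipe_col D z' r") auto
  then have zx: "z \<in> later_crossings r x"
    using z c y z' by (simp add: later_crossings_def)
  have s: "pipe_col D u (Suc r) = row_step D r (pipe_col D u r)" for u
    using r by (simp add: pipe_col_Suc)
  have "next_bump D r c < ?a"
  proof (rule ccontr)
    assume "\<not> next_bump D r c < ?a"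
    moreover have "next_bump D r c \<noteq> ?a"
      using next_bump_notin[OF pipe_dream_top] cross by metis
    ultimately show False
      using c next_bump_less[of c D r] next_bump_notin[OF pipe_dream_top, of r c] by simp
  qed
  then have zs: "pipe_col D z (Suc r) < ?a" using s z c by (simp add: row_step_def)
  have "?a < pipe_col D u (Suc r)" if u: "?a < pipe_col D u r" "u \<noteq> z" for u
  proof (cases "(r, pipe_col D u r) \<in> D")
    case True
    then show ?thesis using u s by (simp add: row_step_def)
  next
    case False
    have "pipe_col D u r \<noteq> c" using pipe_col_inj[OF pipe_dream_top, of u r z] u z by auto
    then have "c < pipe_col D u r" using False c(3)[of "pipe_col D u r"] u by force
    then have "c \<le> next_bump D r (pipe_col D u r)" using next_bump_ge[OF c(2)] by blast
    then show ?thesis using s False c(1) by (simp add: row_step_def)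
  qed
  moreover have "pipe_col D u (Suc r) \<le> pipe_col D u r" for u
    by (rule pipe_col_antimono) simp
  ultimately have "later_crossings (Suc r) x = later_crossings r x - {z}"
    using a zs by (auto simp: later_crossings_def intro: less_le_trans)
  then show ?thesis using zx by simp
qed

text \<open>A pipe right of \<open>x\<close> after the row was right of the next bump before it.
  Either it was already right of \<open>x\<close>, or \<open>x\<close> swept past it; in both cases
  it exits later.\<close>

lemma later_crossings_Suc_bump:
  assumes I: "code_invariant r" and r: "1 \<le> r" and x: "0 < pipe_col D x r"
    and bump: "(r, pipe_col D x r) \<notin> D"
  shows "later_crossings (Suc r) x = {}"
proof (rule ccontr)
  have K: "later_crossings r x = {}" using cross_iff[OF I r x] bump by simp
  assume "later_crossings (Suc r) x \<noteq> {}"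
  then obtain y where y: "pipe_col D x (Suc r) < pipe_col D y (Suc r)" "exit_row y < exit_row x"
    by (auto simp: later_crossings_def)
  have "pipe_col D x (Suc r) = next_bump D r (pipe_col D x r)"
    using bump r by (simp add: pipe_col_Suc row_step_def)
  moreover have "pipe_col D y (Suc r) \<le> pipe_col D y r" by (rule pipe_col_antimono) simp
  ultimately have "next_bump D r (pipe_col D x r) < pipe_col D y r" using y by simp
  moreover have "pipe_col D y r \<le> pipe_col D x r"
    using K y(2) by (auto simp: later_crossings_def not_less)
  moreover have "pipe_col D y r \<noteq> pipe_col D x r"
    using pipe_col_inj[OF pipe_dream_top _ x, of y] y(2) by (metis less_irrefl)
  ultimately have "exit_row x < exit_row y"
    by (intro exit_row_less_between[OF I r x K]) auto
  then show False using y(2) by simp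
qed

lemma code_invariant: "1 \<le> r \<Longrightarrow> code_invariant r"
proof (induction r rule: dec_induct)
  case base
  \<comment> \<open>In row 1 every pipe is in its own column, so \<open>later_crossings\<close> is
    the set counted by \<open>inv_code\<close>.\<close>
  show ?case
    using inv_pos[OF w] by (auto simp: code_invariant_def later_crossings_def inv_code_def Suc_le_eq)
next
  case (step r)
  note I = step.IH and r = step.hyps(1)
  have mono: "pipe_col D x (Suc r) \<le> pipe_col D x r" for x
    by (rule pipe_col_antimono) simp
  have "0 < pipe_col D x (Suc r) \<longleftrightarrow> Suc r \<le> exit_row x" if "1 \<le> x" for x
  proof (cases "0 < pipe_col D x r")
    case True
    then show ?thesis
      using exits_iff[OF I r True] I that by (auto simp: code_invariant_def)
  next
    case False
    then show ?thesis
      using I mono[of x] that by (auto simp: code_invariant_def)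
  qed
  moreover have "inv_code w (pipe_col D x (Suc r)) - r = card (later_crossings (Suc r) x)"
    if x': "0 < pipe_col D x (Suc r)" for x
  proof -
    have x: "0 < pipe_col D x r" using mono[of x] x' by simp
    then have c: "inv_code w (pipe_col D x r) - (r - 1) = card (later_crossings r x)"
      using I by (simp add: code_invariant_def)
    show ?thesis
    proof (cases "(r, pipe_col D x r) \<in> D")
      case True
      then have "pipe_col D x (Suc r) = pipe_col D x r"
        using r by (simp add: pipe_col_Suc row_step_def)
      then show ?thesis
        using later_crossings_Suc_cross[OF I r x True] c r by simp
    next
      case False
      then have "pipe_col D x (Suc r) = next_bump D r (pipe_col D x r)"
        using r by (simp add: pipe_col_Suc row_step_def)
      then have "(r, pipe_col D x (Suc r)) \<notin> D"
        using next_bump_notin[OF pipe_dream_top] by simp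
      \<comment> \<open>The new column has a bump in row \<open>r\<close>; being top-justified, it
        has no crosses further down.\<close>
      then have "inv_code w (pipe_col D x (Suc r)) < r"
        using r x' by (auto simp: top_pipe_dream_def)
      then show ?thesis
        using later_crossings_Suc_bump[OF I r x False] by simp
    qed
  qed
  ultimately show ?case by (simp add: code_invariant_def)
qed

lemma top_in_RPD: "D \<in> RPD w"
proof -
  have "card D = card (Inv_inverse n w)"
    using sum_snd_top[of "\<lambda>_. 1"] by (simp add: split_def)
  moreover have "0 < pipe_col D (w i) i \<and> pipe_col D (w i) (Suc i) = 0" if "1 \<le> i" for i
  proof -
    have "1 \<le> w i" using permutes_Icc_pos[OF w] that by blast
    then show ?thesis
      using code_invariant[OF that] code_invariant[of "Suc i"]
      by (auto simp: code_invariant_def exit_row_w)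
  qed
  ultimately show ?thesis
    using pipe_dream_top card_inversions[OF w]
    by (simp add: RPD_def has_permutation_iff[OF pipe_dream_top])
qed

lemma col_sum_top: "sum snd D = (\<Sum>(x, y)\<in>Inv_inverse n w. x)"
  using sum_snd_top[of "\<lambda>x. x"] by (simp add: split_def)

end

section \<open>Chains\<close>

lemma ladder_move_col_sum:
  assumes "ladder_move D D'" "finite D"
  shows "sum snd D < sum snd D'"
proof -
  obtain i j h k where m: "ladder_movable D i j h k" and D': "D' = insert (h, k) (D - {(i, j)})"
    using assms(1) unfolding ladder_move_def by blast
  have "(i, j) \<in> D" "(h, k) \<notin> D" "j < k"
    using m unfolding ladder_movable_def by auto
  then show ?thesis
    using D' assms(2) by (simp add: sum.remove[of D "(i, j)"])
qed

lemma ladder_moves_col_sum: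
  assumes "ladder_move\<^sup>*\<^sup>* D D'" "finite D"
  shows "D = D' \<or> sum snd D < sum snd D'"
  using assms
proof (induction rule: rtranclp_induct)
  case (step y z)
  then show ?case
    using ladder_move_col_sum[of y z] ladder_moves_decrease[of D y] by auto
qed simp

text \<open>Inverse simple ladder moves lower the column sum by one each and are available until it
  is minimal. Keeping \<open>D\<close> as the largest element lets the chain be extended
  upwards.\<close>

lemma chain_exists:
  assumes w: "w permutes {1..n}" and "D \<in> RPD w" "sum snd D = min_col_sum n w + t"
  shows "\<exists>C\<in>Chains (ladder_order w). finite C \<and> card C = Suc t \<and> D \<in> C \<and>
    (\<forall>E\<in>C. (E, D) \<in> ladder_order w)"
  using assms(2,3)
proof (induction t arbitrary: D)
  case 0
  then have "(D, D) \<in> ladder_order w" by (simp add: ladder_order_def)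
  then show ?case by (intro bexI[of _ "{D}"]) (auto simp: Chains_def)
next
  case (Suc t)
  have "\<not> left_justified D"
    using col_sum_bounds(3)[OF w Suc.prems(1)] Suc.prems(2) by auto
  then obtain D' h i j where "inverse_ladder D D' h i j"
    using inverse_ladder_exists[OF w Suc.prems(1)] by blast
  then interpret inverse_ladder D D' h i j .
  obtain C where C: "C \<in> Chains (ladder_order w)" "finite C" "card C = Suc t" "D' \<in> C"
    "\<And>E. E \<in> C \<Longrightarrow> (E, D') \<in> ladder_order w"
    using Suc.IH[OF RPD_D'[OF Suc.prems(1)]] Suc.prems(2) col_sum_D' by auto
  have step: "(D', D) \<in> ladder_order w"
    using ladder_move_D' RPD_D' Suc.prems(1) by (auto simp: ladder_order_def)
  have below: "(E, D) \<in> ladder_order w" if "E \<in> C" for E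
    using C(5)[OF that] step by (auto simp: ladder_order_def)
  have refl: "(D, D) \<in> ladder_order w" using Suc.prems(1) by (simp add: ladder_order_def)
  have "D \<notin> C"
  proof
    assume "D \<in> C"
    then have "ladder_move\<^sup>*\<^sup>* D D'" using C(5) by (simp add: ladder_order_def)
    then show False using ladder_moves_col_sum[OF _ finite_D] col_sum_D' by fastforce
  qed
  then show ?case
    using C below refl by (intro bexI[of _ "insert D C"]) (auto simp: Chains_def)
qed

text \<open>The column sum is injective on a chain, and its values lie in an interval of
  \<open>?N + 1\<close> numbers.\<close>

lemma chain_card_le:
  assumes w: "w permutes {1..n}" and C: "C \<in> Chains (ladder_order w)"
  shows "finite C \<and> card C \<le> 1 + (\<Sum>(x, y)\<in>Inv_inverse n w. R_stat w x y)"
proof -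
  let ?m = "min_col_sum n w" and ?N = "\<Sum>(x, y)\<in>Inv_inverse n w. R_stat w x y"
  have rel: "(D, E) \<in> ladder_order w \<or> (E, D) \<in> ladder_order w" if "D \<in> C" "E \<in> C" for D E
    using C that by (auto simp: Chains_def)
  have "inj_on (sum snd) C"
  proof (rule inj_onI)
    fix D E :: "(nat \<times> nat) set" assume DE: "D \<in> C" "E \<in> C" "sum snd D = sum snd E"
    have "F = G" if "(F, G) \<in> ladder_order w" "sum snd F = sum snd G" for F G
      using that ladder_moves_col_sum[of F G] by (auto simp: ladder_order_def RPD_def pipe_dream_def)
    then show "D = E" using rel[OF DE(1,2)] DE(3) by metis
  qed
  moreover have "sum snd ` C \<subseteq> {?m..?m + ?N}"
  proof (rule image_subsetI)
    fix D assume "D \<in> C"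
    then have "D \<in> RPD w" using rel[of D D] by (auto simp: ladder_order_def)
    then show "sum snd D \<in> {?m..?m + ?N}"
      using col_sum_bounds(1,2)[OF w, of D] sum_fst_Inv_inverse[OF w] by simp
  qed
  ultimately have "finite C" "card C \<le> card {?m..?m + ?N}"
    using finite_imageD[of "sum snd" C] finite_subset[OF _ finite_atLeastAtMost]
      card_inj_on_le[of "sum snd" C "{?m..?m + ?N}"] by blast+
  then show ?thesis by simp
qed

theorem corollary5p8:
  fixes n :: nat and w :: "nat \<Rightarrow> nat"
  assumes "w permutes {1..n}"
  shows "(\<exists>C\<in>Chains (ladder_order w). finite C \<and>
            card C = 1 + (\<Sum>(x, y)\<in>Inv_inverse n w. R_stat w x y)) \<and>
         (\<forall>C\<in>Chains (ladder_order w). finite C \<and>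
            card C \<le> 1 + (\<Sum>(x, y)\<in>Inv_inverse n w. R_stat w x y))"
proof -
  interpret top_dream n w by (unfold_locales) (rule assms)
  \<comment> \<open>The top-justified pipe dream attains the upper bound, so its excess over the
    minimum is the sum of the \<open>R_stat\<close> values.\<close>
  have "sum snd D = min_col_sum n w + (\<Sum>(x, y)\<in>Inv_inverse n w. R_stat w x y)"
    unfolding col_sum_top by (rule sum_fst_Inv_inverse[OF assms])
  then show ?thesis
    using chain_exists[OF assms top_in_RPD] chain_card_le[OF assms] by fastforce
qed

end
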